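(* Let $q=2^{2k+1}$ for some positive integer $k$. Then there exists an irregular orthomorphism over $\mathbb{F}_q$.
   Context: Let $\mathbb{F}_q$ be the finite field of order $q$. An orthomorphism is a permutation $\theta$ of $\mathbb{F}_q$ such that $x\mapsto\theta(x)-x$ is also a permutation. For $k\mid(q-1)$, fix a generator $g$ of $\mathbb{F}_q^*$ and let $C_{k,i}=\{g^j: j\equiv i\pmod k\}$, $0\le i<k$. A cyclotomic map of index $k$ with multipliers $[a_0,\dots,a_{k-1}]$ is $\theta(0)=0$, $\theta(x)=a_ix$ for $x\in C_{k,i}$. $\mathscr{C}_k(q)$ is the set of orthomorphisms that are cyclotomic maps of index $k$, and $\mathscr{D}_k(q)=\mathscr{C}_k(q)\setminus\bigcup_{\ell<k,\ \ell\mid(q-1)}\mathscr{C}_\ell(q)$. An orthomorphism in $\mathscr{D}_{q-1}(q)$ is called non-cyclotomic. For an orthomorphism $\theta$ and $h\in\mathbb{F}_q$, the translation $T_h[\theta]$ is the orthomorphism $x\mapsto\theta(x+h)-\theta(h)$. An orthomorphism $\theta$ is irregular if $T_h[\theta]$ is non-cyclotomic for every $h\in\mathbb{F}_q$. *)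

theory Defs
  imports "HOL-Number_Theory.Cong" "HOL-Library.Cardinality"
begin

text \<open>
  The field \<open>F\<^sub>q\<close> is a type \<open>'a\<close> of sort \<open>{field, finite}\<close> with \<open>q = CARD('a)\<close>.
\<close>

definition orthomorphism :: "('a::{field,finite} \<Rightarrow> 'a) \<Rightarrow> bool" where
  "orthomorphism \<theta> \<longleftrightarrow> bij \<theta> \<and> bij (\<lambda>x. \<theta> x - x)"

definition mult_generator :: "'a::{field,finite} \<Rightarrow> bool" where
  "mult_generator g \<longleftrightarrow> range (\<lambda>j::nat. g ^ j) = UNIV - {0}"

text \<open>
  Restricting to natural exponents loses nothing: \<open>g\<close> has order \<open>q - 1\<close>, a multiple of \<open>k\<close>.
\<close>

definition cyclotomic_coset :: "'a::{field,finite} \<Rightarrow> nat \<Rightarrow> nat \<Rightarrow> 'a set" where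
  "cyclotomic_coset g k i = {g ^ j | j. [j = i] (mod k)}"

text \<open>
  The multipliers \<open>[a\<^sub>0, \<dots>, a\<^bsub>k-1\<^esub>]\<close> are the values of \<open>a\<close> below \<open>k\<close>; other values are irrelevant.
\<close>

definition cyclotomic_map ::
  "'a::{field,finite} \<Rightarrow> nat \<Rightarrow> (nat \<Rightarrow> 'a) \<Rightarrow> ('a \<Rightarrow> 'a) \<Rightarrow> bool" where
  "cyclotomic_map g k a \<theta> \<longleftrightarrow>
     k dvd CARD('a) - 1 \<and> \<theta> 0 = 0 \<and> (\<forall>i<k. \<forall>x\<in>cyclotomic_coset g k i. \<theta> x = a i * x)"

text \<open>The sets \<open>C\<^sub>k(q)\<close> and \<open>D\<^sub>k(q)\<close>; as sets of maps they do not depend on the choice of \<open>g\<close>.\<close>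

definition cyclotomic_orthomorphisms ::
  "'a::{field,finite} \<Rightarrow> nat \<Rightarrow> ('a \<Rightarrow> 'a) set" where
  "cyclotomic_orthomorphisms g k = {\<theta>. orthomorphism \<theta> \<and> (\<exists>a. cyclotomic_map g k a \<theta>)}"

definition least_index_orthomorphisms ::
  "'a::{field,finite} \<Rightarrow> nat \<Rightarrow> ('a \<Rightarrow> 'a) set" where
  "least_index_orthomorphisms g k =
     cyclotomic_orthomorphisms g k -
     (\<Union>l\<in>{l. l < k \<and> l dvd CARD('a) - 1}. cyclotomic_orthomorphisms g l)"

definition non_cyclotomic :: "'a::{field,finite} \<Rightarrow> ('a \<Rightarrow> 'a) \<Rightarrow> bool" where
  "non_cyclotomic g \<theta> \<longleftrightarrow> \<theta> \<in> least_index_orthomorphisms g (CARD('a) - 1)"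

definition translation :: "'a::{field,finite} \<Rightarrow> ('a \<Rightarrow> 'a) \<Rightarrow> 'a \<Rightarrow> 'a" where
  "translation h \<theta> = (\<lambda>x. \<theta> (x + h) - \<theta> h)"

definition irregular :: "'a::{field,finite} \<Rightarrow> ('a \<Rightarrow> 'a) \<Rightarrow> bool" where
  "irregular g \<theta> \<longleftrightarrow> orthomorphism \<theta> \<and> (\<forall>h. non_cyclotomic g (translation h \<theta>))"

end

theory Submission
  imports Defs "HOL-Number_Theory.Residues"
begin

text \<open>
  Every additive map equals all of its translations, so it suffices to find an additive
  orthomorphism that is not homogeneous under any \<open>\<omega> \<noteq> 1\<close>. Take \<open>L x = t x + Tr(x) u\<close> with
  \<open>Tr\<close> the absolute trace and \<open>t \<noteq> 0, 1\<close>. Both \<open>L\<close> and \<open>L - id\<close> are injective as soon as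
  \<open>Tr(u / t) = Tr(u / (t - 1)) = 0\<close>, and some \<open>u \<noteq> 0\<close> satisfies this by pigeonhole, as the
  field has more than four elements. If \<open>L \<omega> = \<omega> L 1\<close>, then \<open>Tr \<omega> = \<omega> Tr 1 = \<omega>\<close> because
  the degree is odd, and so \<open>\<omega> \<in> {0, 1}\<close>.
\<close>

lemma CHAR_eq_if_CARD_prime_power:
  assumes "prime p" and "CARD('a::{field,finite}) = p ^ n"
  shows "CHAR('a) = p"
proof -
  have "prime CHAR('a)"
    by (rule prime_CHAR_semidom) (simp add: finite_imp_CHAR_pos)
  moreover have "CHAR('a) dvd p ^ n"
    using CHAR_dvd_CARD[where 'a = 'a] by (simp add: assms(2))
  ultimately show ?thesis
    using assms(1) by (metis prime_dvd_power primes_dvd_imp_eq)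
qed

text \<open>Multiplication by \<open>x\<close> permutes the nonzero elements, so the factor
  \<open>x ^ (CARD('a) - 1)\<close> leaves their product unchanged.\<close>

lemma power_CARD_minus_1_eq_1:
  fixes x :: "'a::{field,finite}"
  assumes "x \<noteq> 0"
  shows "x ^ (CARD('a) - 1) = 1"
proof -
  let ?U = "UNIV - {0::'a}"
  have "bij_betw ((*) x) ?U ?U"
    using assms by (intro bij_betwI[where g = "\<lambda>y. y / x"]) auto
  then have "(\<Prod>y\<in>?U. x * y) = \<Prod>?U"
    by (rule prod.reindex_bij_betw)
  then have "x ^ card ?U * \<Prod>?U = \<Prod>?U"
    by (simp add: prod.distrib)
  moreover have "\<Prod>?U \<noteq> 0"
    by simp
  ultimately show ?thesis
    by simp
qed

text \<open>For the field with \<open>2 ^ n\<close> elements this is the absolute trace, a sum of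
  Frobenius conjugates with values kept in the field itself.\<close>

definition binary_trace :: "nat \<Rightarrow> 'a::comm_semiring_1 \<Rightarrow> 'a" where
  "binary_trace n x = (\<Sum>i<n. x ^ 2 ^ i)"

lemma binary_trace_add:
  fixes x y :: "'a::comm_semiring_1"
  assumes "CHAR('a) = 2"
  shows "binary_trace n (x + y) = binary_trace n x + binary_trace n y"
  using freshmans_dream'[where 'a = 'a] assms
  by (simp add: binary_trace_def sum.distrib)

text \<open>Squaring shifts the conjugates cyclically, so the trace is idempotent.\<close>

lemma binary_trace_in_prime_field:
  fixes x :: "'a::idom"
  assumes "CHAR('a) = 2" and x: "x ^ 2 ^ n = x"
  shows "binary_trace n x \<in> {0, 1}"
proof -
  have "(\<Sum>i<n. x ^ 2 ^ i)\<^sup>2 = (\<Sum>i<n. (x ^ 2 ^ i)\<^sup>2)"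
    using assms(1) by (intro freshmans_dream_sum) auto
  moreover have "(x ^ 2 ^ i)\<^sup>2 = x ^ 2 ^ Suc i" for i
    by (simp flip: power_mult add: mult.commute)
  \<comment> \<open>Both sides equal the sum over \<open>i < Suc n\<close>: the added
    \<open>x\<close> is its bottom term on the left and its top term on the right.\<close>
  moreover have "(\<Sum>i<n. x ^ 2 ^ Suc i) + x = (\<Sum>i<n. x ^ 2 ^ i) + x"
    using sum.lessThan_Suc_shift[of "\<lambda>i. x ^ 2 ^ i" n] x by (simp add: add.commute)
  ultimately have "(binary_trace n x)\<^sup>2 = binary_trace n x"
    by (simp add: binary_trace_def)
  then show ?thesis
    by (simp add: power2_eq_square)
qed

lemma binary_trace_1_odd:
  assumes "CHAR('a::comm_semiring_1) = 2" and "odd n"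
  shows "binary_trace n (1::'a) = 1"
proof -
  have "(2::'a) = 0"
    using of_nat_CHAR[where 'a = 'a] by (simp add: assms(1))
  then show ?thesis
    using assms(2) by (auto simp: binary_trace_def elim!: oddE)
qed

text \<open>If two arguments collide and \<open>\<phi>\<close> agrees on them, they coincide because
  \<open>t\<close> is nonzero. Otherwise they differ by \<open>u / t\<close> up to sign, where
  \<open>\<phi>\<close> vanishes, a contradiction.\<close>

lemma bij_rank_one_perturbation:
  fixes t u :: "'a::{field,finite}" and \<phi> :: "'a \<Rightarrow> 'a"
  assumes diff: "\<And>x y. \<phi> (x - y) = \<phi> x - \<phi> y"
    and range: "\<And>x. \<phi> x \<in> {0, 1}"
    and t: "t \<noteq> 0" and u: "\<phi> (u / t) = 0"
  shows "bij (\<lambda>x. t * x + \<phi> x * u)"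
proof -
  have "x = y" if eq: "t * x + \<phi> x * u = t * y + \<phi> y * u" for x y
  proof -
    have *: "t * (y - x) = \<phi> (x - y) * u"
      using eq by (simp add: diff algebra_simps)
    have neg: "\<phi> (x - y) = - \<phi> (y - x)"
      by (simp add: diff)
    show ?thesis
    proof (cases "\<phi> (x - y) = 0")
      case True
      then show ?thesis
        using * t by simp
    next
      case False
      then have one: "\<phi> (x - y) = 1"
        using range by blast
      then have "y - x = u / t"
        using * t by (simp add: field_simps)
      then show ?thesis
        using u one neg by simp
    qed
  qed
  then have "inj (\<lambda>x. t * x + \<phi> x * u)"
    by (rule injI)
  then show ?thesis
    by (simp add: bij_def finite_UNIV_inj_surj)
qed

text \<open>The pair of functionals takes at most four values; the difference of two colliding
  arguments is the required \<open>u\<close>.\<close>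

lemma ex_nonzero_common_zero:
  fixes \<phi> \<psi> :: "'a::{ab_group_add,finite} \<Rightarrow> 'b::ring_1"
  assumes "\<And>x y. \<phi> (x - y) = \<phi> x - \<phi> y" and "\<And>x y. \<psi> (x - y) = \<psi> x - \<psi> y"
    and "\<And>x. \<phi> x \<in> {0, 1}" and "\<And>x. \<psi> x \<in> {0, 1}"
    and "CARD('a) > 4"
  obtains u where "u \<noteq> 0" "\<phi> u = 0" "\<psi> u = 0"
proof -
  let ?f = "\<lambda>x. (\<phi> x, \<psi> x)"
  have "card (range ?f) \<le> card ({0, 1 :: 'b} \<times> {0, 1 :: 'b})"
    using assms(3,4) by (intro card_mono) auto
  also have "\<dots> < CARD('a)"
    using assms(5) by (simp add: card_cartesian_product)
  finally have "\<not> inj ?f"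
    by (rule pigeonhole)
  then obtain x y where "x \<noteq> y" "\<phi> x = \<phi> y" "\<psi> x = \<psi> y"
    by (auto simp: inj_def)
  then show thesis
    using that[of "x - y"] assms(1,2) by simp
qed

lemma mult_generator_nonzero:
  assumes "mult_generator g"
  shows "g \<noteq> 0"
proof -
  have "g ^ 1 \<in> UNIV - {0}"
    using assms unfolding mult_generator_def by blast
  then show ?thesis
    by simp
qed

text \<open>Otherwise the powers of \<open>g\<close> would take at most \<open>l\<close> values, too
  few to exhaust the nonzero elements.\<close>

lemma mult_generator_power_neq_1:
  fixes g :: "'a::{field,finite}"
  assumes g: "mult_generator g" and l: "0 < l" "l < CARD('a) - 1"
  shows "g ^ l \<noteq> 1"
proof
  assume gl: "g ^ l = 1"
  have "g ^ j = g ^ (j mod l)" for j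
  proof -
    have "g ^ j = g ^ (l * (j div l) + j mod l)"
      by simp
    then show ?thesis
      by (simp only: power_add power_mult gl) simp
  qed
  then have "range ((^) g) \<subseteq> (^) g ` {..<l}"
    using l by (metis image_subsetI lessThan_iff mod_less_divisor rangeI imageI)
  then have "card (range ((^) g)) \<le> l"
    by (metis card_image_le card_lessThan card_mono finite_imageI finite_lessThan order_trans)
  then show False
    using g l by (simp add: mult_generator_def)
qed

text \<open>At the maximal index every coset is a single element \<open>g ^ i\<close>, so a
  multiplier can be chosen for each point separately.\<close>

lemma cyclotomic_map_max_index:
  fixes g :: "'a::{field,finite}"
  assumes g: "mult_generator g" and "\<theta> 0 = 0"
  shows "cyclotomic_map g (CARD('a) - 1) (\<lambda>i. \<theta> (g ^ i) / g ^ i) \<theta>"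
proof -
  have "g ^ j = g ^ i" if "[j = i] (mod CARD('a) - 1)" for i j
  proof -
    have red: "g ^ m = g ^ (m mod (CARD('a) - 1))" for m
    proof -
      have "g ^ m = g ^ ((CARD('a) - 1) * (m div (CARD('a) - 1)) + m mod (CARD('a) - 1))"
        by simp
      then show ?thesis
        by (simp only: power_add power_mult
            power_CARD_minus_1_eq_1[OF mult_generator_nonzero[OF g]]) simp
    qed
    show ?thesis
      using red[of i] red[of j] that by (simp add: cong_def)
  qed
  then show ?thesis
    using assms(2) mult_generator_nonzero[OF g]
    by (auto simp: cyclotomic_map_def cyclotomic_coset_def)
qed

text \<open>Both \<open>1\<close> and \<open>g ^ l\<close> lie in coset 0 and share the multiplier
  \<open>a 0\<close>, which is \<open>\<theta> 1\<close>.\<close>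

lemma cyclotomic_map_homogeneous:
  assumes "cyclotomic_map g l a \<theta>" and "l > 0"
  shows "\<theta> (g ^ l) = g ^ l * \<theta> 1"
proof -
  have "g ^ 0 \<in> cyclotomic_coset g l 0" "g ^ l \<in> cyclotomic_coset g l 0"
    unfolding cyclotomic_coset_def by (blast intro: cong_refl, force simp: cong_def)
  then have "\<theta> (g ^ l) = a 0 * g ^ l" "\<theta> (g ^ 0) = a 0 * g ^ 0"
    using assms unfolding cyclotomic_map_def by blast+
  then show ?thesis
    by simp
qed

text \<open>A smaller index \<open>l\<close> would make \<open>\<theta>\<close> homogeneous at
  \<open>g ^ l\<close>, which is neither 0 nor 1.\<close>

lemma non_cyclotomicI:
  fixes g :: "'a::{field,finite}"
  assumes g: "mult_generator g" and \<theta>: "orthomorphism \<theta>" "\<theta> 0 = 0"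
    and hom: "\<And>\<omega>. \<omega> \<noteq> 0 \<Longrightarrow> \<omega> \<noteq> 1 \<Longrightarrow> \<theta> \<omega> \<noteq> \<omega> * \<theta> 1"
    and q: "CARD('a) > 2"
  shows "non_cyclotomic g \<theta>"
proof -
  have "\<not> cyclotomic_map g l a \<theta>" if l: "l < CARD('a) - 1" "l dvd CARD('a) - 1" for l a
  proof
    assume cyc: "cyclotomic_map g l a \<theta>"
    \<comment> \<open>Index 0 would satisfy the coset condition vacuously, but 0 does not divide a
      positive number.\<close>
    have "l > 0"
      using l by (auto intro: Nat.gr0I)
    then show False
      using cyclotomic_map_homogeneous[OF cyc] hom[of "g ^ l"] mult_generator_nonzero[OF g]
        mult_generator_power_neq_1[OF g _ l(1)] by simp
  qed
  then show ?thesis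
    using cyclotomic_map_max_index[where \<theta> = \<theta>, OF g \<theta>(2)] \<theta>(1)
    unfolding non_cyclotomic_def least_index_orthomorphisms_def cyclotomic_orthomorphisms_def
    by blast
qed

theorem theorem3p5:
  fixes k :: nat and g :: "'a::{field,finite}"
  assumes "k > 0"
    and "CARD('a) = 2 ^ (2 * k + 1)"
    and "mult_generator g"
  shows "\<exists>\<theta>::'a \<Rightarrow> 'a. irregular g \<theta>"
proof -
  define n where "n = 2 * k + 1"
  define Tr :: "'a \<Rightarrow> 'a" where "Tr = binary_trace n"
  have q: "CARD('a) = 2 ^ n"
    using assms(2) by (simp add: n_def)
  \<comment> \<open>Positivity of \<open>k\<close> gives at least eight elements, beyond the four
    value pairs of the pigeonhole argument.\<close>
  have "(2::nat) ^ 3 \<le> 2 ^ n"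
    using assms(1) by (intro power_increasing) (auto simp: n_def)
  then have q_gt: "CARD('a) > 4"
    by (simp add: q)
  have char: "CHAR('a) = 2"
    by (rule CHAR_eq_if_CARD_prime_power[OF two_is_prime_nat q])
  have frob: "x ^ 2 ^ n = x" for x :: 'a
  proof (cases "x = 0")
    case False
    then show ?thesis
      using power_CARD_minus_1_eq_1[of x] power_minus_mult[of "2 ^ n" x] by (simp add: q)
  qed simp
  have Tr_add: "Tr (x + y) = Tr x + Tr y" for x y
    by (simp add: Tr_def binary_trace_add[OF char])
  have Tr_diff: "Tr (x - y) = Tr x - Tr y" for x y
    using Tr_add[of "x - y" y] by (simp add: algebra_simps)
  have Tr_range: "Tr x \<in> {0, 1}" for x
    unfolding Tr_def by (rule binary_trace_in_prime_field[OF char frob])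
  have Tr_1: "Tr 1 = 1"
    unfolding Tr_def by (rule binary_trace_1_odd[OF char]) (simp add: n_def)
  have "\<not> UNIV \<subseteq> {0, 1 :: 'a}"
    using card_mono[of "{0, 1 :: 'a}" UNIV] q_gt by auto
  then obtain t :: 'a where t: "t \<noteq> 0" "t \<noteq> 1"
    by blast
  obtain u where u: "u \<noteq> 0" "Tr (u / t) = 0" "Tr (u / (t - 1)) = 0"
    by (rule ex_nonzero_common_zero[of "\<lambda>u. Tr (u / t)" "\<lambda>u. Tr (u / (t - 1))"])
      (use q_gt Tr_range in \<open>auto simp: diff_divide_distrib Tr_diff\<close>)
  define L where "L = (\<lambda>x. t * x + Tr x * u)"
  have "bij L"
    unfolding L_def using t u Tr_diff Tr_range by (intro bij_rank_one_perturbation) auto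
  \<comment> \<open>Subtracting the identity only changes the slope from \<open>t\<close> to
    \<open>t - 1\<close>.\<close>
  moreover have "bij (\<lambda>x. (t - 1) * x + Tr x * u)"
    using t u Tr_diff Tr_range by (intro bij_rank_one_perturbation) auto
  then have "bij (\<lambda>x. L x - x)"
    by (simp add: L_def algebra_simps)
  ultimately have orth: "orthomorphism L"
    by (simp add: orthomorphism_def)
  have translation: "translation h L = L" for h
    by (auto simp: translation_def L_def Tr_add algebra_simps)
  have "L \<omega> \<noteq> \<omega> * L 1" if "\<omega> \<noteq> 0" "\<omega> \<noteq> 1" for \<omega>
  proof
    assume "L \<omega> = \<omega> * L 1"
    \<comment> \<open>The terms with \<open>t\<close> cancel, leaving
      \<open>Tr \<omega> * u = \<omega> * u\<close>.\<close>
    then have "Tr \<omega> = \<omega>"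
      using u(1) by (simp add: L_def Tr_1 algebra_simps)
    then show False
      using Tr_range[of \<omega>] that by simp
  qed
  moreover have "L 0 = 0"
    using Tr_diff[of 0 0] by (simp add: L_def)
  ultimately have "non_cyclotomic g L"
    using assms(3) orth q_gt by (intro non_cyclotomicI) auto
  then show ?thesis
    using orth translation by (auto simp: irregular_def)
qed

end
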